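(* Every minimal polytope allows an IP simplex structure.
   Context: A polytope in $\mathbb{R}^n$ (the convex hull of finitely many points) has the IP property if the origin $\mathbf 0$ is in its interior; for a lower dimensional polytope the interior is taken relative to its linear span. An IP simplex is a simplex with the IP property. A minimal polytope is a polytope with the IP property such that, if any one of its vertices is removed, the convex hull of the remaining vertices does not have the IP property (a lower dimensional polytope is called minimal if it is minimal in its linear span). For an $n$-dimensional minimal polytope $\nabla$ with $k$ vertices, an IP simplex structure is a collection of subsets $S_i$, $1\le i\le k-n$, of the set of vertices of $\nabla$ such that: the convex hull of the vertices in each $S_i$ is an IP simplex; $\nabla_j=\mathrm{conv}\bigcup_{i=1}^jS_i$ is a (lower dimensional) minimal polytope for every $j\in\{1,\dots,k-n\}$; $\nabla_{k-n}=\nabla$; and $S_j\setminus\bigcup_{i=1}^{j-1}S_i$ contains at least two vertices for every $j$. *)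

theory Defs
  imports "HOL-Analysis.Analysis"
begin

definition vertices :: "'a::euclidean_space set \<Rightarrow> 'a set" where
  "vertices P = {v. v extreme_point_of P}"

(* For full-dimensional P the linear span is the whole space, so a single clause
   covers both the full-dimensional and the lower-dimensional case. *)
definition has_IP :: "'a::euclidean_space set \<Rightarrow> bool" where
  "has_IP P \<longleftrightarrow> 0 \<in> (top_of_set (span P)) interior_of P"

definition IP_simplex :: "'a::euclidean_space set \<Rightarrow> bool" where
  "IP_simplex P \<longleftrightarrow> (\<exists>d. d simplex P) \<and> has_IP P"

definition minimal_polytope :: "'a::euclidean_space set \<Rightarrow> bool" where
  "minimal_polytope P \<longleftrightarrow>
     polytope P \<and> has_IP P \<and>
     (\<forall>v \<in> vertices P. \<not> has_IP (convex hull (vertices P - {v})))"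

(* A polytope with the IP property is nonempty and has more vertices than its
   dimension, so neither nat nor the subtraction truncates for minimal P. *)
definition IP_structure_length :: "'a::euclidean_space set \<Rightarrow> nat" where
  "IP_structure_length P = card (vertices P) - nat (aff_dim P)"

(* Only the values S i for i in {1..IP_structure_length P} are constrained. *)
definition IP_simplex_structure :: "'a::euclidean_space set \<Rightarrow> (nat \<Rightarrow> 'a set) \<Rightarrow> bool" where
  "IP_simplex_structure P S \<longleftrightarrow>
     (let m = IP_structure_length P in
       (\<forall>i \<in> {1..m}. S i \<subseteq> vertices P \<and> IP_simplex (convex hull (S i))) \<and>
       (\<forall>j \<in> {1..m}. minimal_polytope (convex hull (\<Union>i \<in> {1..j}. S i))) \<and>
       convex hull (\<Union>i \<in> {1..m}. S i) = P \<and>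
       (\<forall>j \<in> {1..m}. card (S j - (\<Union>i \<in> {1..<j}. S i)) \<ge> 2))"

end

theory Submission
  imports Defs
begin

text \<open>
  The origin lies in the relative interior of the convex hull of a finite nonempty set iff the
  points of the set satisfy a linear relation with all coefficients strictly positive
  (\<open>has_IP_convex_hull\<close>). The whole statement thus becomes one about strictly positive relations
  on the vertex set \<open>V\<close>. IP simplices correspond to circuits, the inclusion-minimal nonempty sets
  that carry such a relation, and every point of a set with such a relation lies on a circuit
  (\<open>pos_circuit_through\<close>).

  The set \<open>V\<close> is exhausted by adding circuits. The number of circuits must be exactly
  \<open>card V - dim V\<close>, the dimension of the space of linear relations on \<open>V\<close>, so each circuit may
  contribute only one new relation up to scaling and up to relations on the set \<open>W\<close> reached so far.
  This is achieved by choosing the circuit with as few points outside \<open>W\<close> as possible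
  (\<open>dim_add_minimal_pos_dependent\<close>): a second new relation could be subtracted from the first one
  until a coefficient outside \<open>W\<close> vanishes; negative coefficients on \<open>W\<close> are then repaired by
  adding a large multiple of the positive relation on \<open>W\<close> (\<open>pos_dependent_absorb\<close>), and a set with
  fewer points outside \<open>W\<close> results.

  Minimality of the polytope accounts for the rest. It passes to every subset of \<open>V\<close> with a strictly
  positive relation (\<open>pos_dependent_delete_lift\<close>), so all intermediate polytopes are minimal. If a
  step added just one point, deleting that point from the enlarged set would restore the previous
  set, which carries a strictly positive relation itself, against minimality. Thus every step adds
  at least two points.
\<close>

section \<open>Strictly positive linear relations\<close>

text \<open>The empty set counts as positively dependent; it is the start of the chain of circuits.\<close>

definition pos_dependent :: "'a::real_vector set \<Rightarrow> bool" where
  "pos_dependent V \<longleftrightarrow>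
     finite V \<and> (\<exists>c. (\<forall>v\<in>V. 0 < c v) \<and> (\<Sum>v\<in>V. c v *\<^sub>R v) = 0)"

definition pos_circuit :: "'a::real_vector set \<Rightarrow> bool" where
  "pos_circuit S \<longleftrightarrow>
     S \<noteq> {} \<and> pos_dependent S \<and> (\<forall>T. T \<subset> S \<longrightarrow> T \<noteq> {} \<longrightarrow> \<not> pos_dependent T)"

lemma pos_dependent_empty: "pos_dependent {}"
  by (simp add: pos_dependent_def)

lemma pos_dependent_finite: "pos_dependent V \<Longrightarrow> finite V"
  by (simp add: pos_dependent_def)

lemma sum_zero_extension:
  fixes c :: "'a::real_vector \<Rightarrow> real"
  assumes "finite U" "A \<subseteq> U"
  shows "(\<Sum>v\<in>U. (if v \<in> A then c v else 0) *\<^sub>R v) = (\<Sum>v\<in>A. c v *\<^sub>R v)"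
  by (rule sum.mono_neutral_cong_right) (use assms in auto)

text \<open>
  Only the signs outside \<open>B\<close> matter: a large multiple of the positive relation on \<open>B\<close> outweighs
  whatever coefficients \<open>e\<close> has there.
\<close>

lemma pos_dependent_absorb:
  fixes e :: "'a::real_vector \<Rightarrow> real"
  assumes B: "pos_dependent B" "B \<subseteq> U" and U: "finite U"
    and e: "(\<Sum>v\<in>U. e v *\<^sub>R v) = 0" "\<And>v. v \<in> U - B \<Longrightarrow> 0 < e v"
  shows "pos_dependent U"
proof -
  obtain b where b: "\<And>v. v \<in> B \<Longrightarrow> 0 < b v" "(\<Sum>v\<in>B. b v *\<^sub>R v) = 0"
    using B(1) by (auto simp: pos_dependent_def)
  have finB: "finite B" using B U finite_subset by blast
  \<comment> \<open>The sum is a crude bound for the maximum of the quotients, and the 1 makes it strict.\<close>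
  define N where "N = (\<Sum>v\<in>B. \<bar>e v\<bar> / b v) + 1"
  define f where "f v = e v + N * (if v \<in> B then b v else 0)" for v
  have "0 < f v" if "v \<in> U" for v
  proof (cases "v \<in> B")
    case True
    have "\<bar>e v\<bar> / b v \<le> (\<Sum>v\<in>B. \<bar>e v\<bar> / b v)"
      by (rule member_le_sum) (use True finB b(1) in \<open>auto intro!: divide_nonneg_pos\<close>)
    then have "\<bar>e v\<bar> / b v < N" by (simp add: N_def)
    then have "\<bar>e v\<bar> < N * b v" using b(1)[OF True] by (simp add: pos_divide_less_eq)
    then show ?thesis using True by (simp add: f_def)
  next
    case False
    then show ?thesis using e(2) that by (simp add: f_def)
  qed
  moreover have "(\<Sum>v\<in>U. f v *\<^sub>R v)
      = (\<Sum>v\<in>U. e v *\<^sub>R v) + N *\<^sub>R (\<Sum>v\<in>U. (if v \<in> B then b v else 0) *\<^sub>R v)"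
    unfolding f_def by (simp add: scaleR_add_left sum.distrib scaleR_sum_right)
  then have "(\<Sum>v\<in>U. f v *\<^sub>R v) = 0"
    by (simp only: e(1) sum_zero_extension[OF U B(2)] b(2)) simp
  ultimately show ?thesis using U by (auto simp: pos_dependent_def)
qed

lemma pos_dependent_Un:
  assumes "pos_dependent A" "pos_dependent B"
  shows "pos_dependent (A \<union> B)"
proof -
  obtain a where a: "\<And>v. v \<in> A \<Longrightarrow> 0 < a v" "(\<Sum>v\<in>A. a v *\<^sub>R v) = 0"
    using assms(1) by (auto simp: pos_dependent_def)
  have fin: "finite (A \<union> B)" using assms by (simp add: pos_dependent_finite)
  show ?thesis
  proof (rule pos_dependent_absorb[OF assms(2)])
    show "(\<Sum>v\<in>A \<union> B. (if v \<in> A then a v else 0) *\<^sub>R v) = 0"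
      using sum_zero_extension[OF fin, of A a] a(2) by simp
  qed (use a(1) fin in auto)
qed

lemma pos_dependent_UNION:
  assumes "finite I" "\<And>i. i \<in> I \<Longrightarrow> pos_dependent (S i)"
  shows "pos_dependent (\<Union>i\<in>I. S i)"
  using assms by (induction I rule: finite_induct) (auto simp: pos_dependent_empty pos_dependent_Un)

text \<open>
  The ratio test of the simplex method: moving from \<open>c\<close> in the direction \<open>- d\<close>, stop when
  the first coordinate reaches zero, that is, at the least quotient \<open>c v / d v\<close> with \<open>d v > 0\<close>.
\<close>

lemma subtract_until_zero:
  fixes c d :: "'a \<Rightarrow> real"
  assumes "finite T" "\<And>v. v \<in> T \<Longrightarrow> 0 < c v" "x \<in> T" "0 < d x"
  shows "\<exists>r>0. (\<forall>v\<in>T. r * d v \<le> c v) \<and> (\<exists>y\<in>T. r * d y = c y)"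
proof -
  define T' where "T' = {v\<in>T. 0 < d v}"
  have T': "finite T'" "T' \<noteq> {}" using assms by (auto simp: T'_def)
  define y where "y = arg_min_on (\<lambda>v. c v / d v) T'"
  have y: "y \<in> T'" using arg_min_if_finite(1)[OF T'] by (simp add: y_def)
  have le: "c y / d y \<le> c v / d v" if "v \<in> T'" for v
    using arg_min_least[OF T' that] by (simp add: y_def)
  define r where "r = c y / d y"
  have "0 < r" using y assms(2) by (simp add: r_def T'_def)
  moreover have "r * d v \<le> c v" if v: "v \<in> T" for v
  proof (cases "0 < d v")
    case True
    then show ?thesis using le[of v] v by (simp add: T'_def r_def pos_le_divide_eq)
  next
    case False
    then have "r * d v \<le> 0" using \<open>0 < r\<close> by (simp add: mult_nonneg_nonpos)
    then show ?thesis using assms(2)[OF v] by linarith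
  qed
  moreover have "y \<in> T" "r * d y = c y" using y by (auto simp: T'_def r_def)
  ultimately show ?thesis by blast
qed

lemma pos_dependent_support:
  fixes e :: "'a::real_vector \<Rightarrow> real"
  assumes "finite U" "(\<Sum>v\<in>U. e v *\<^sub>R v) = 0" "\<And>v. v \<in> U \<Longrightarrow> 0 \<le> e v"
  shows "pos_dependent {v\<in>U. 0 < e v}"
proof -
  have "(\<Sum>v\<in>{v\<in>U. 0 < e v}. e v *\<^sub>R v) = (\<Sum>v\<in>U. e v *\<^sub>R v)"
    by (rule sum.mono_neutral_left) (use assms(1,3) in \<open>auto simp: less_le\<close>)
  then show ?thesis using assms(1,2) unfolding pos_dependent_def by auto
qed

section \<open>Circuits\<close>

text \<open>
  If a smaller positively dependent set \<open>T\<close> misses \<open>x\<close>, subtracting its relation until a coefficient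
  vanishes leaves the coefficient of \<open>x\<close> untouched, and so yields a smaller set that contains \<open>x\<close>.
\<close>

lemma pos_circuit_through:
  assumes "pos_dependent U" "x \<in> U"
  shows "\<exists>S\<subseteq>U. pos_circuit S \<and> x \<in> S"
  using assms
proof (induction "card U" arbitrary: U rule: less_induct)
  case less
  have fin: "finite U" using less.prems by (simp add: pos_dependent_finite)
  show ?case
  proof (cases "pos_circuit U")
    case True
    then show ?thesis using less.prems by blast
  next
    case False
    then obtain T where T: "T \<subset> U" "T \<noteq> {}" "pos_dependent T"
      using less.prems by (auto simp: pos_circuit_def)
    have "\<exists>T'. T' \<subset> U \<and> pos_dependent T' \<and> x \<in> T'"
    proof (cases "x \<in> T")
      case True
      then show ?thesis using T by blast
    next
      case xT: False
      obtain c where c: "\<And>v. v \<in> U \<Longrightarrow> 0 < c v" "(\<Sum>v\<in>U. c v *\<^sub>R v) = 0"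
        using less.prems(1) by (auto simp: pos_dependent_def)
      obtain d where d: "\<And>v. v \<in> T \<Longrightarrow> 0 < d v" "(\<Sum>v\<in>T. d v *\<^sub>R v) = 0"
        using T(3) by (auto simp: pos_dependent_def)
      define d' where "d' v = (if v \<in> T then d v else 0)" for v
      obtain z where "z \<in> T" using T(2) by blast
      then have "z \<in> U" "0 < d' z" using T(1) d(1) by (auto simp: d'_def)
      then obtain r y where ry: "0 < r" "\<And>v. v \<in> U \<Longrightarrow> r * d' v \<le> c v" "y \<in> U" "r * d' y = c y"
        using subtract_until_zero[of U c z d', OF fin c(1)] by auto
      define e where "e v = c v - r * d' v" for v
      have "(\<Sum>v\<in>U. e v *\<^sub>R v) = (\<Sum>v\<in>U. c v *\<^sub>R v) - r *\<^sub>R (\<Sum>v\<in>U. d' v *\<^sub>R v)"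
        by (simp add: e_def scaleR_diff_left sum_subtractf scaleR_sum_right)
      also have "\<dots> = 0"
        using sum_zero_extension[OF fin, of T d] T(1) c(2) d(2) by (simp add: d'_def psubset_imp_subset)
      finally have "pos_dependent {v\<in>U. 0 < e v}"
        using pos_dependent_support[OF fin, of e] ry(2) by (simp add: e_def)
      moreover have "e y = 0" using ry(4) by (simp add: e_def)
      then have "{v\<in>U. 0 < e v} \<subset> U" using ry(3) by force
      moreover have "x \<in> {v\<in>U. 0 < e v}"
        using less.prems(2) c(1) xT by (simp add: e_def d'_def)
      ultimately show ?thesis by blast
    qed
    then obtain T' where T': "T' \<subset> U" "pos_dependent T'" "x \<in> T'" by blast
    have "\<exists>S\<subseteq>T'. pos_circuit S \<and> x \<in> S"
      using less.hyps[OF psubset_card_mono[OF fin T'(1)] T'(2,3)] .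
    then show ?thesis using T'(1) by (meson order_trans psubset_imp_subset)
  qed
qed

text \<open>
  The coefficients of an affine relation sum to zero, hence take both signs. A positive one allows
  it to be subtracted from the relation of the circuit until a point drops out; a negative one
  ensures that not all points drop out.
\<close>

lemma pos_circuit_affine_independent:
  fixes S :: "'a::real_vector set"
  assumes "pos_circuit S"
  shows "\<not> affine_dependent S"
proof
  assume dep: "affine_dependent S"
  have fin: "finite S" using assms by (auto simp: pos_circuit_def pos_dependent_finite)
  obtain c where c: "\<And>v. v \<in> S \<Longrightarrow> 0 < c v" "(\<Sum>v\<in>S. c v *\<^sub>R v) = 0"
    using assms by (auto simp: pos_circuit_def pos_dependent_def)
  obtain u where u: "sum u S = 0" "\<exists>v\<in>S. u v \<noteq> 0" "(\<Sum>v\<in>S. u v *\<^sub>R v) = 0"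
    using dep affine_dependent_explicit_finite[OF fin] by blast
  have pos: "\<exists>x\<in>S. 0 < u x"
  proof (rule ccontr)
    assume "\<not> ?thesis"
    then show False using u sum_nonneg_eq_0_iff[OF fin, of "\<lambda>v. - u v"]
      by (force simp: not_less sum_negf)
  qed
  have neg: "\<exists>x\<in>S. u x < 0"
  proof (rule ccontr)
    assume "\<not> ?thesis"
    then show False using u sum_nonneg_eq_0_iff[OF fin, of u] by (force simp: not_less)
  qed
  obtain x where x: "x \<in> S" "0 < u x" using pos by blast
  obtain r y where ry: "0 < r" "\<And>v. v \<in> S \<Longrightarrow> r * u v \<le> c v" "y \<in> S" "r * u y = c y"
    using subtract_until_zero[of S c x u, OF fin c(1) x] by auto
  define e where "e v = c v - r * u v" for v
  have "(\<Sum>v\<in>S. e v *\<^sub>R v) = (\<Sum>v\<in>S. c v *\<^sub>R v) - r *\<^sub>R (\<Sum>v\<in>S. u v *\<^sub>R v)"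
    by (simp add: e_def scaleR_diff_left sum_subtractf scaleR_sum_right)
  then have "pos_dependent {v\<in>S. 0 < e v}"
    using pos_dependent_support[OF fin, of e] ry(2) c(2) u(3) by (simp add: e_def)
  moreover have "e y = 0" using ry(4) by (simp add: e_def)
  then have "{v\<in>S. 0 < e v} \<subset> S" using ry(3) by force
  moreover obtain z where z: "z \<in> S" "u z < 0" using neg by blast
  have "r * u z < 0" using ry(1) z(2) by (simp add: mult_pos_neg)
  then have "z \<in> {v\<in>S. 0 < e v}" using c(1)[OF z(1)] z(1) by (simp add: e_def)
  ultimately show False using assms by (auto simp: pos_circuit_def)
qed

section \<open>Adding one circuit at a time\<close>

text \<open>
  The equation says that modulo \<open>span W\<close> the points of \<open>S - W\<close> satisfy exactly one linear relation
  up to scaling. Any relation independent of that of \<open>S\<close> could be used to make \<open>S - W\<close> smaller.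
\<close>

lemma dim_add_minimal_pos_dependent:
  fixes W S V :: "'a::euclidean_space set"
  assumes W: "pos_dependent W" "W \<subseteq> V"
    and S: "pos_dependent S" "S \<subseteq> V" "\<not> S \<subseteq> W"
    and min: "\<And>U. pos_dependent U \<Longrightarrow> U \<subseteq> V \<Longrightarrow> \<not> U \<subseteq> W \<Longrightarrow> card (S - W) \<le> card (U - W)"
  shows "dim (W \<union> S) + 1 = dim W + card (S - W)"
proof -
  have fin: "finite W" "finite S" "finite (W \<union> S)"
    using W S by (simp_all add: pos_dependent_finite)
  obtain s where s: "\<And>v. v \<in> S \<Longrightarrow> 0 < s v" "(\<Sum>v\<in>S. s v *\<^sub>R v) = 0"
    using S(1) by (auto simp: pos_dependent_def)
  define s' where "s' v = (if v \<in> S then s v else 0)" for v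
  have s': "(\<Sum>v\<in>W \<union> S. s' v *\<^sub>R v) = 0"
    using sum_zero_extension[OF fin(3), of S s] s(2) by (simp add: s'_def)
  have no_relation: "d x = 0" if d: "(\<Sum>v\<in>W \<union> S. d v *\<^sub>R v) = 0" and t: "t \<in> S - W" "d t = 0"
    and x: "x \<in> S - W" for d :: "'a \<Rightarrow> real" and t x
  proof (rule ccontr)
    assume "d x \<noteq> 0"
    \<comment> \<open>The sign makes the coefficient at \<open>x\<close> positive, so that the subtraction comes to an end.\<close>
    define d' where "d' v = sgn (d x) * d v" for v
    have d'x: "0 < d' x" using \<open>d x \<noteq> 0\<close> by (simp add: d'_def sgn_if)
    obtain r y where ry: "0 < r" "\<And>v. v \<in> S - W \<Longrightarrow> r * d' v \<le> s' v" "y \<in> S - W" "r * d' y = s' y"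
      using subtract_until_zero[of "S - W" s' x d'] fin s(1) x d'x by (auto simp: s'_def)
    define e where "e v = s' v - r * d' v" for v
    have "(\<Sum>v\<in>W \<union> S. e v *\<^sub>R v)
        = (\<Sum>v\<in>W \<union> S. s' v *\<^sub>R v) - (r * sgn (d x)) *\<^sub>R (\<Sum>v\<in>W \<union> S. d v *\<^sub>R v)"
      by (simp add: e_def d'_def scaleR_diff_left sum_subtractf scaleR_sum_right mult.assoc)
    then have e0: "(\<Sum>v\<in>W \<union> S. e v *\<^sub>R v) = 0" using s' d by simp
    define T where "T = {v \<in> S - W. 0 < e v}"
    have "(\<Sum>v\<in>W \<union> T. e v *\<^sub>R v) = (\<Sum>v\<in>W \<union> S. e v *\<^sub>R v)"
      by (rule sum.mono_neutral_left) (use fin ry(2) in \<open>auto simp: T_def e_def less_le\<close>)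
    then have "pos_dependent (W \<union> T)"
      by (intro pos_dependent_absorb[OF W(1), of _ e]) (use fin e0 in \<open>auto simp: T_def\<close>)
    moreover have "W \<union> T \<subseteq> V" using W S by (auto simp: T_def)
    \<comment> \<open>Since \<open>d\<close> vanishes at \<open>t\<close>, the point \<open>t\<close> survives the subtraction.\<close>
    moreover have "t \<in> T" using t s(1) by (auto simp: T_def e_def d'_def s'_def)
    then have "\<not> W \<union> T \<subseteq> W" using t by blast
    ultimately have "card (S - W) \<le> card (W \<union> T - W)" using min by blast
    also have "W \<union> T - W = T" by (auto simp: T_def)
    also have "card T < card (S - W)"
    proof -
      have "e y = 0" using ry(4) by (simp add: e_def)
      then have "T \<subset> S - W" using ry(3) unfolding T_def by force
      then show ?thesis using fin by (simp add: psubset_card_mono)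
    qed
    finally show False by simp
  qed
  obtain t where t: "t \<in> S - W" using S(3) by blast
  obtain B where B: "B \<subseteq> W" "independent B" "W \<subseteq> span B" "card B = dim W"
    using basis_exists by metis
  define R where "R = S - W - {t}"
  have finBR: "finite (B \<union> R)" "finite B" "finite R"
    using B(1) fin by (auto simp: R_def intro: finite_subset)
  have "B \<inter> R = {}" using B(1) by (auto simp: R_def)
  have indep: "independent (B \<union> R)"
  proof
    assume "dependent (B \<union> R)"
    then obtain u where u: "\<exists>v\<in>B \<union> R. u v \<noteq> 0" "(\<Sum>v\<in>B \<union> R. u v *\<^sub>R v) = 0"
      using dependent_finite[OF finBR(1)] by blast
    define u' where "u' v = (if v \<in> B \<union> R then u v else 0)" for v
    have "B \<union> R \<subseteq> W \<union> S" using B(1) by (auto simp: R_def)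
    then have u'_sum: "(\<Sum>v\<in>W \<union> S. u' v *\<^sub>R v) = 0"
      using sum_zero_extension[OF fin(3), of "B \<union> R" u] u(2) by (simp add: u'_def)
    have u't: "u' t = 0" using t B(1) by (auto simp: u'_def R_def)
    have uR: "u v = 0" if v: "v \<in> R" for v
    proof -
      have "u' v = 0" using no_relation[OF u'_sum t u't] v by (simp add: R_def)
      then show ?thesis using v by (simp add: u'_def)
    qed
    have "(\<Sum>v\<in>B. u v *\<^sub>R v) = (\<Sum>v\<in>B \<union> R. u v *\<^sub>R v)"
      by (rule sum.mono_neutral_left) (use finBR uR in auto)
    then have "\<forall>v\<in>B. u v = 0" using B(2) dependent_finite[OF finBR(2)] u(2) by auto
    then show False using u(1) uR by blast
  qed
  have "t \<in> span (B \<union> R)"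
  proof -
    have WR: "W \<subseteq> span (B \<union> R)" "R \<subseteq> span (B \<union> R)"
      using B(3) span_mono[of B "B \<union> R"] span_superset by blast+
    have "s t *\<^sub>R t + (\<Sum>v\<in>S - {t}. s v *\<^sub>R v) = 0"
      using s(2) sum.remove[OF fin(2), of t "\<lambda>v. s v *\<^sub>R v"] t by simp
    moreover have "(\<Sum>v\<in>S - {t}. s v *\<^sub>R v) \<in> span (B \<union> R)"
      by (intro span_sum span_scale) (use WR in \<open>auto simp: R_def\<close>)
    ultimately have "s t *\<^sub>R t \<in> span (B \<union> R)"
      by (simp add: eq_neg_iff_add_eq_0[symmetric] span_neg)
    then have "(1 / s t) *\<^sub>R s t *\<^sub>R t \<in> span (B \<union> R)" by (rule span_scale)
    then show ?thesis using s(1)[of t] t by simp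
  qed
  then have "W \<union> S \<subseteq> span (B \<union> R)"
    using B(3) span_mono[of B "B \<union> R"] span_superset[of "B \<union> R"] by (auto simp: R_def)
  moreover have "B \<union> R \<subseteq> W \<union> S" using B(1) by (auto simp: R_def)
  ultimately have "dim (W \<union> S) = card (B \<union> R)"
    using indep by (intro dim_unique) auto
  also have "\<dots> = dim W + card R"
    using finBR \<open>B \<inter> R = {}\<close> B(4) by (simp add: card_Un_disjoint)
  also have "card (S - W) = card R + 1"
    unfolding R_def using t fin card_Suc_Diff1[of "S - W" t] by simp
  ultimately show ?thesis by simp
qed

text \<open>
  Minimizing over all positively dependent sets and only then passing to a circuit inside the
  minimizer through a point outside \<open>W\<close> keeps the competitors in the minimization free of any
  condition that would have to be re-established.
\<close>

lemma add_circuit: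
  fixes V :: "'a::euclidean_space set"
  assumes V: "pos_dependent V" and W: "pos_dependent W" "W \<subset> V"
  shows "\<exists>S\<subseteq>V. pos_circuit S \<and> \<not> S \<subseteq> W \<and> dim (W \<union> S) + 1 = dim W + card (S - W)"
proof -
  let ?P = "\<lambda>S. pos_dependent S \<and> S \<subseteq> V \<and> \<not> S \<subseteq> W"
  have "?P V" using V W by blast
  from ex_has_least_nat[of ?P, OF this, of "\<lambda>S. card (S - W)"]
  obtain S0 where S0: "?P S0" "\<And>U. ?P U \<Longrightarrow> card (S0 - W) \<le> card (U - W)" by auto
  obtain x where x: "x \<in> S0" "x \<notin> W" using S0(1) by blast
  obtain S where S: "S \<subseteq> S0" "pos_circuit S" "x \<in> S"
    using pos_circuit_through[of S0 x] S0(1) x(1) by blast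
  have "card (S - W) \<le> card (S0 - W)"
    using S(1) S0(1) by (intro card_mono) (auto simp: pos_dependent_finite)
  moreover have "?P S" using S S0(1) x by (auto simp: pos_circuit_def)
  ultimately have "dim (W \<union> S) + 1 = dim W + card (S - W)"
    using W S0(2) by (intro dim_add_minimal_pos_dependent[of W V S]) (auto intro: order_trans)
  then show ?thesis using S \<open>?P S\<close> by blast
qed

text \<open>
  The equation for \<open>card W\<close> says that \<open>m\<close> is the dimension of the space of linear relations on \<open>W\<close>.
\<close>

definition circuit_chain :: "'a::euclidean_space set \<Rightarrow> nat \<Rightarrow> (nat \<Rightarrow> 'a set) \<Rightarrow> bool" where
  "circuit_chain W m S \<longleftrightarrow>
     (\<forall>i\<in>{1..m}. pos_circuit (S i) \<and> \<not> S i \<subseteq> (\<Union>k\<in>{1..<i}. S k)) \<and>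
     (\<Union>i\<in>{1..m}. S i) = W \<and> card W = dim W + m"

lemma pos_dependent_circuit_Union:
  assumes "circuit_chain W m S" "I \<subseteq> {1..m}"
  shows "pos_dependent (\<Union>i\<in>I. S i)"
  using assms by (intro pos_dependent_UNION) (auto simp: circuit_chain_def pos_circuit_def finite_subset)

lemma circuit_chain_exists:
  fixes V :: "'a::euclidean_space set"
  assumes V: "pos_dependent V"
  shows "\<exists>m S. circuit_chain V m S"
proof -
  define chains where "chains = {W. W \<subseteq> V \<and> (\<exists>m S. circuit_chain W m S)}"
  have finV: "finite V" using V by (rule pos_dependent_finite)
  have "{} \<in> chains" by (auto simp: chains_def circuit_chain_def intro!: exI[of _ 0])
  moreover have "finite chains" using finV by (simp add: chains_def)
  ultimately obtain W where W: "W \<in> chains" "\<forall>U\<in>chains. W \<subseteq> U \<longrightarrow> W = U"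
    using finite_has_maximal[of chains] by blast
  obtain m S where mS: "circuit_chain W m S" using W(1) by (auto simp: chains_def)
  have "W = V"
  proof (rule ccontr)
    assume "W \<noteq> V"
    then have "W \<subset> V"
      using W(1) by (auto simp: chains_def)
    have pW: "pos_dependent W"
      using pos_dependent_circuit_Union[OF mS, of "{1..m}"] mS by (simp add: circuit_chain_def)
    obtain C where C: "C \<subseteq> V" "pos_circuit C" "\<not> C \<subseteq> W"
        "dim (W \<union> C) + 1 = dim W + card (C - W)"
      using add_circuit[OF V pW \<open>W \<subset> V\<close>] by blast
    have "circuit_chain (W \<union> C) (Suc m) (S(Suc m := C))"
      unfolding circuit_chain_def
    proof (intro conjI ballI)
      have U: "(\<Union>k\<in>{1..<i}. (S(Suc m := C)) k) = (\<Union>k\<in>{1..<i}. S k)" if "i \<le> Suc m" for i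
        using that by (intro SUP_cong) auto
      have Um: "(\<Union>k\<in>{1..<Suc m}. S k) = W"
        using mS by (simp add: circuit_chain_def atLeastLessThanSuc_atLeastAtMost)
      fix i assume i: "i \<in> {1..Suc m}"
      show "pos_circuit ((S(Suc m := C)) i)"
        using C(2) mS i by (auto simp: circuit_chain_def)
      show "\<not> (S(Suc m := C)) i \<subseteq> (\<Union>k\<in>{1..<i}. (S(Suc m := C)) k)"
      proof (cases "i = Suc m")
        case True
        then show ?thesis using U[of i] Um C(3) by simp
      next
        case False
        then have "i \<in> {1..m}" using i by auto
        then show ?thesis using U[of i] False mS by (simp add: circuit_chain_def)
      qed
    next
      have "(\<Union>i\<in>{1..m}. (S(Suc m := C)) i) = (\<Union>i\<in>{1..m}. S i)"
        by (intro SUP_cong) auto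
      also have "\<dots> = W" using mS by (simp only: circuit_chain_def)
      finally have old: "(\<Union>i\<in>{1..m}. (S(Suc m := C)) i) = W" .
      have "{1..Suc m} = insert (Suc m) {1..m}" by auto
      then show "(\<Union>i\<in>{1..Suc m}. (S(Suc m := C)) i) = W \<union> C"
        by (simp only: UN_insert old fun_upd_same Un_commute)
    next
      have "card (W \<union> C) = card W + card (C - W)"
        using finite_subset[OF C(1) finV] pos_dependent_finite[OF pW]
          card_Un_disjoint[of W "C - W"] by simp
      then show "card (W \<union> C) = dim (W \<union> C) + Suc m"
        using C(4) mS by (simp add: circuit_chain_def)
    qed
    then have "W \<union> C \<in> chains" using C(1) \<open>W \<subset> V\<close> by (auto simp: chains_def)
    then show False using W(2) C(3) by blast
  qed
  then show ?thesis using mS by blast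
qed

section \<open>Minimality\<close>

text \<open>
  Read contrapositively, minimality is inherited by \<open>W\<close> from \<open>V\<close>. A multiple of the
  relation on \<open>W\<close> cancels \<open>w\<close> from the relation on \<open>V\<close>; the signs spoiled on \<open>W - {w}\<close> are repaired
  by the positive relation there.
\<close>

lemma pos_dependent_delete_lift:
  fixes V :: "'a::real_vector set"
  assumes V: "pos_dependent V" and W: "pos_dependent W" "W \<subseteq> V" "w \<in> W"
    and del: "pos_dependent (W - {w})"
  shows "pos_dependent (V - {w})"
proof -
  have fin: "finite V" using V by (rule pos_dependent_finite)
  obtain c where c: "\<And>v. v \<in> V \<Longrightarrow> 0 < c v" "(\<Sum>v\<in>V. c v *\<^sub>R v) = 0"
    using V by (auto simp: pos_dependent_def)
  obtain a where a: "\<And>v. v \<in> W \<Longrightarrow> 0 < a v" "(\<Sum>v\<in>W. a v *\<^sub>R v) = 0"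
    using W(1) by (auto simp: pos_dependent_def)
  define a' where "a' v = (if v \<in> W then a v else 0)" for v
  define e where "e v = c v - (c w / a w) * a' v" for v
  have "(\<Sum>v\<in>V. e v *\<^sub>R v) = (\<Sum>v\<in>V. c v *\<^sub>R v) - (c w / a w) *\<^sub>R (\<Sum>v\<in>V. a' v *\<^sub>R v)"
    by (simp add: e_def scaleR_diff_left sum_subtractf scaleR_sum_right)
  also have "\<dots> = 0"
    using sum_zero_extension[OF fin W(2), of a] c(2) a(2) by (simp add: a'_def)
  finally have "(\<Sum>v\<in>V. e v *\<^sub>R v) = 0" .
  moreover have "e w = 0" using W(3) a(1)[of w] by (simp add: e_def a'_def)
  ultimately have "(\<Sum>v\<in>V - {w}. e v *\<^sub>R v) = 0"
    using fin by (simp add: sum_diff1)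
  then show ?thesis
    by (rule pos_dependent_absorb[OF del, rotated 2])
      (use W fin c(1) in \<open>auto simp: e_def a'_def\<close>)
qed

section \<open>Translation to polytopes\<close>

lemma has_IP_iff_rel_interior:
  "has_IP P \<longleftrightarrow> 0 \<in> rel_interior P"
proof (cases "0 \<in> P")
  case True
  then have "affine hull P = span P" by (simp add: affine_hull_span_0 hull_inc)
  then show ?thesis by (simp only: has_IP_def interior_of_def rel_interior_def)
next
  case False
  then have "0 \<notin> (top_of_set (span P)) interior_of P" "0 \<notin> rel_interior P"
    using subsetD[OF interior_of_subset] subsetD[OF rel_interior_subset] by metis+
  then show ?thesis by (simp add: has_IP_def)
qed

text \<open>
  The relative interior of the hull consists of the convex combinations with all weights positive;
  a strictly positive relation becomes such a combination after normalization.
\<close>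

lemma has_IP_convex_hull:
  fixes V :: "'a::euclidean_space set"
  assumes fin: "finite V"
  shows "has_IP (convex hull V) \<longleftrightarrow> V \<noteq> {} \<and> pos_dependent V"
proof -
  have "rel_interior (convex hull V) =
      {\<Sum>v\<in>V. c v *\<^sub>R v | c. (\<forall>v\<in>V. 0 < c v) \<and> sum c V = 1}"
  proof -
    have *: "(\<Union>v\<in>V. {v}) = V" by blast
    have "rel_interior (convex hull V) = {sum (\<lambda>i. c i *\<^sub>R s i) V | c s. (\<forall>i\<in>V. c i > 0) \<and> sum c V = 1 \<and>
      (\<forall>i\<in>V. s i \<in> rel_interior {i})}"
      using rel_interior_convex_hull_union[OF fin, of "\<lambda>v. {v}"] unfolding * by simp
    also have "\<dots> = {\<Sum>v\<in>V. c v *\<^sub>R v | c. (\<forall>v\<in>V. 0 < c v) \<and> sum c V = 1}"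
      (is "?A = ?B")
    proof
      show "?A \<subseteq> ?B"
      proof
        fix x assume "x \<in> ?A"
        then obtain c s where "x = (\<Sum>i\<in>V. c i *\<^sub>R s i)" and cs: "\<forall>i\<in>V. 0 < c i" "sum c V = 1"
          and s: "\<forall>i\<in>V. s i \<in> rel_interior {i}" by blast
        then have "x = (\<Sum>i\<in>V. c i *\<^sub>R i)" by (simp cong: sum.cong)
        then show "x \<in> ?B" using cs by blast
      qed
      show "?B \<subseteq> ?A"
      proof
        fix x assume "x \<in> ?B"
        then obtain c where "x = (\<Sum>v\<in>V. c v *\<^sub>R v)" "\<forall>v\<in>V. 0 < c v" "sum c V = 1" by blast
        then show "x \<in> ?A" by (intro CollectI exI[of _ c] exI[of _ "\<lambda>v. v"]) simp
      qed
    qed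
    finally show ?thesis .
  qed
  moreover have "(\<exists>c. (\<forall>v\<in>V. 0 < c v) \<and> sum c V = 1 \<and> (\<Sum>v\<in>V. c v *\<^sub>R v) = 0)
      \<longleftrightarrow> V \<noteq> {} \<and> pos_dependent V" (is "?L \<longleftrightarrow> ?R")
  proof
    assume ?L then show ?R using fin by (auto simp: pos_dependent_def)
  next
    assume R: ?R
    then obtain c where c: "\<And>v. v \<in> V \<Longrightarrow> 0 < c v" "(\<Sum>v\<in>V. c v *\<^sub>R v) = 0"
      by (auto simp: pos_dependent_def)
    define M where "M = sum c V"
    have M: "0 < M" unfolding M_def using R fin c(1) by (intro sum_pos) auto
    have "(\<Sum>v\<in>V. (c v / M) *\<^sub>R v) = (1 / M) *\<^sub>R (\<Sum>v\<in>V. c v *\<^sub>R v)"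
      by (simp add: scaleR_sum_right)
    moreover have "(\<Sum>v\<in>V. c v / M) = 1"
      using M by (simp add: M_def flip: sum_divide_distrib)
    ultimately show ?L using c M by (intro exI[of _ "\<lambda>v. c v / M"]) auto
  qed
  moreover have "0 \<in> {\<Sum>v\<in>V. c v *\<^sub>R v | c. (\<forall>v\<in>V. 0 < c v) \<and> sum c V = 1} \<longleftrightarrow>
      (\<exists>c. (\<forall>v\<in>V. 0 < c v) \<and> sum c V = 1 \<and> (\<Sum>v\<in>V. c v *\<^sub>R v) = 0)"
    by (simp add: eq_commute[of 0] conj_commute conj_left_commute)
  ultimately show ?thesis by (simp only: has_IP_iff_rel_interior)
qed

text \<open>
  The hull of \<open>W\<close> lies in \<open>P\<close>, and an extreme point of a set is extreme in every smaller set
  that contains it.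
\<close>

lemma vertices_convex_hull_subset:
  fixes P :: "'a::euclidean_space set"
  assumes P: "convex P" and W: "W \<subseteq> vertices P"
  shows "vertices (convex hull W) = W"
proof
  show "vertices (convex hull W) \<subseteq> W"
    using extreme_points_of_convex_hull[of W] by (simp only: vertices_def)
  have sub: "convex hull W \<subseteq> P"
  proof (rule hull_minimal)
    show "W \<subseteq> P" using W by (auto simp: vertices_def extreme_point_of_def)
  qed (rule P)
  show "W \<subseteq> vertices (convex hull W)"
  proof
    fix w assume w: "w \<in> W"
    then have "w extreme_point_of P" using W by (auto simp: vertices_def)
    moreover have "w \<in> convex hull W" using w by (simp add: hull_inc)
    ultimately show "w \<in> vertices (convex hull W)"
      using sub unfolding vertices_def extreme_point_of_def by blast
  qed
qed

theorem mainTheorem6: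
  fixes P :: "'a::euclidean_space set"
  assumes "minimal_polytope P"
    and "aff_dim P \<ge> 1"
  shows "\<exists>S. IP_simplex_structure P S"
proof -
  define V where "V = vertices P"
  have poly: "polytope P" and IP: "has_IP P"
    and no_smaller: "\<And>v. v \<in> V \<Longrightarrow> \<not> has_IP (convex hull (V - {v}))"
    using assms(1) by (auto simp: minimal_polytope_def V_def)
  have convP: "convex P" using poly by (rule polytope_imp_convex)
  have finV: "finite V"
    using finite_polyhedron_extreme_points[OF polytope_imp_polyhedron[OF poly]]
    by (simp add: V_def vertices_def)
  have P: "P = convex hull V"
    using Krein_Milman_Minkowski[OF polytope_imp_compact[OF poly] convP]
    by (simp add: V_def vertices_def)
  have V: "pos_dependent V" "V \<noteq> {}" using IP has_IP_convex_hull[OF finV] P by auto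
  \<comment> \<open>The empty set is positively dependent but its hull lacks the IP property; the dimension
    bound rules out that deleting a vertex leaves the empty set.\<close>
  have minV: "\<not> pos_dependent (V - {v})" if v: "v \<in> V" for v
  proof -
    have "V \<noteq> {v}" using assms(2) by (auto simp: P)
    then have "V - {v} \<noteq> {}" using v by blast
    then show ?thesis using no_smaller[OF v] has_IP_convex_hull[of "V - {v}"] finV by simp
  qed
  have minW: "\<not> pos_dependent (W - {w})" if "pos_dependent W" "W \<subseteq> V" "w \<in> W" for W w
    using pos_dependent_delete_lift[OF V(1) that] minV that by blast
  have minimal_hull: "minimal_polytope (convex hull W)" if W: "pos_dependent W" "W \<subseteq> V" "W \<noteq> {}" for W
  proof -
    have finW: "finite W" using W(1) by (rule pos_dependent_finite)
    have "vertices (convex hull W) = W"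
      using vertices_convex_hull_subset[OF convP] W(2) by (simp add: V_def)
    then show ?thesis
      unfolding minimal_polytope_def
      using W finW minW[OF W(1,2)] by (auto simp: has_IP_convex_hull polytope_convex_hull)
  qed
  obtain m S where mS: "circuit_chain V m S" using circuit_chain_exists[OF V(1)] by blast
  have circ: "pos_circuit (S i)" "S i \<subseteq> V" "\<not> S i \<subseteq> (\<Union>k\<in>{1..<i}. S k)" if "i \<in> {1..m}" for i
    using mS that by (auto simp: circuit_chain_def)
  have length: "IP_structure_length P = m"
  proof -
    have "0 \<in> affine hull V"
      using IP convex_hull_subset_affine_hull[of V] rel_interior_subset[of P] P
      by (auto simp: has_IP_iff_rel_interior)
    then have "aff_dim P = int (dim V)"
      by (simp add: P aff_dim_convex_hull aff_dim_zero)
    moreover have "card V = dim V + m" using mS by (simp add: circuit_chain_def)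
    ultimately show ?thesis by (simp add: IP_structure_length_def flip: V_def)
  qed
  have simplex: "IP_simplex (convex hull (S i))" if i: "i \<in> {1..m}" for i
  proof -
    have "finite (S i)" using circ(2)[OF i] finV finite_subset by blast
    moreover have "(int (card (S i)) - 1) simplex (convex hull (S i))"
      using pos_circuit_affine_independent[OF circ(1)[OF i]] by (auto simp: simplex_def)
    ultimately show ?thesis
      using circ(1)[OF i] by (auto simp: IP_simplex_def has_IP_convex_hull pos_circuit_def)
  qed
  have steps: "minimal_polytope (convex hull (\<Union>i\<in>{1..j}. S i))" if j: "j \<in> {1..m}" for j
  proof (rule minimal_hull)
    show "pos_dependent (\<Union>i\<in>{1..j}. S i)"
      using pos_dependent_circuit_Union[OF mS] j by auto
    show "(\<Union>i\<in>{1..j}. S i) \<subseteq> V" using circ(2) j by fastforce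
    show "(\<Union>i\<in>{1..j}. S i) \<noteq> {}" using circ(1)[OF j] j by (auto simp: pos_circuit_def)
  qed
  have two_new: "2 \<le> card (S j - (\<Union>i\<in>{1..<j}. S i))" if j: "j \<in> {1..m}" for j
  proof (rule ccontr)
    define W where "W = (\<Union>i\<in>{1..<j}. S i)"
    assume "\<not> ?thesis"
    then have "card (S j - W) < 2" by (simp add: W_def)
    moreover have "finite (S j - W)" using circ(2)[OF j] finV finite_subset by blast
    moreover have "S j - W \<noteq> {}" using circ(3)[OF j] by (simp add: W_def)
    ultimately have "card (S j - W) = 1"
      using card_gt_0_iff[of "S j - W"] by linarith
    then obtain w where w: "S j - W = {w}" by (auto simp: card_1_singleton_iff)
    have "{1..<j} \<subseteq> {1..m}" using j by auto
    then have posW: "pos_dependent W"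
      unfolding W_def by (rule pos_dependent_circuit_Union[OF mS])
    then have "pos_dependent (W \<union> S j)"
      using circ(1)[OF j] by (simp add: pos_circuit_def pos_dependent_Un)
    moreover have "S i \<subseteq> V" if "i \<in> {1..<j}" for i
      using circ(2)[of i] that j by simp
    then have "W \<subseteq> V" unfolding W_def by (rule UN_least)
    then have "W \<union> S j \<subseteq> V" using circ(2)[OF j] by blast
    moreover have "w \<in> W \<union> S j" using w by blast
    ultimately have "\<not> pos_dependent (W \<union> S j - {w})" by (rule minW)
    moreover have "W \<union> S j - {w} = W" using w by blast
    ultimately show False using posW by simp
  qed
  have "convex hull (\<Union>i\<in>{1..m}. S i) = P"
    using mS P by (simp add: circuit_chain_def)
  then have "IP_simplex_structure P S"
    unfolding IP_simplex_structure_def Let_def length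
    using circ(2) simplex steps two_new by (auto simp flip: V_def)
  then show ?thesis by blast
qed

end
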